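(* For any finite poset $\mathcal{P}=(N,\preccurlyeq)$ there exists an $\mathrm{M}^\natural$-concave function $f\colon 2^N\to\mathbb{R}$ such that for every $X\subseteq N$, $f(X)=0$ if $X\in\mathcal{I}(\mathcal{P})$ and $f(X)>0$ otherwise.
   Context: For a finite poset $\mathcal{P}=(N,\preccurlyeq)$, a subset $I\subseteq N$ is an ideal if $x\preccurlyeq y\in I$ implies $x\in I$ for all $x,y\in N$; $\mathcal{I}(\mathcal{P})$ denotes the set of all ideals of $\mathcal{P}$. A set function $f\colon 2^N\to\mathbb{R}$ is $\mathrm{M}^\natural$-concave if for all $X,Y\subseteq N$ and every $i\in X\setminus Y$, either $f(X)+f(Y)\le f(X\setminus\{i\})+f(Y\cup\{i\})$, or there exists $j\in Y\setminus X$ with $f(X)+f(Y)\le f((X\setminus\{i\})\cup\{j\})+f((Y\cup\{i\})\setminus\{j\})$. *)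

theory Defs
  imports Complex_Main
begin

definition poset_ideals :: "'a set \<Rightarrow> 'a rel \<Rightarrow> 'a set set" where
  "poset_ideals N r = {I. I \<subseteq> N \<and> (\<forall>x\<in>N. \<forall>y\<in>N. (x, y) \<in> r \<and> y \<in> I \<longrightarrow> x \<in> I)}"

text \<open>
  A set function on the power set of \<open>N\<close> is a total function on \<open>'a set\<close>;
  only its values on subsets of \<open>N\<close> are constrained.
\<close>

definition M_natural_concave_on :: "'a set \<Rightarrow> ('a set \<Rightarrow> real) \<Rightarrow> bool" where
  "M_natural_concave_on N f \<longleftrightarrow>
    (\<forall>X Y. X \<subseteq> N \<and> Y \<subseteq> N \<longrightarrow> (\<forall>i \<in> X - Y.
       f X + f Y \<le> f (X - {i}) + f (Y \<union> {i}) \<or>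
       (\<exists>j \<in> Y - X. f X + f Y \<le> f ((X - {i}) \<union> {j}) + f ((Y \<union> {i}) - {j}))))"

end

theory Submission
  imports Defs
begin

text \<open>
  Call a set of pairs \<open>(y, x)\<close> with \<open>x \<preceq> y\<close> a matching if both projections are injective on it,
  and let \<open>f X\<close> be the largest number of off-diagonal pairs in a matching with domain \<open>X\<close>.
  The exchange property follows by swapping two optimal matchings along the alternating path
  that starts at \<open>i\<close>.  If \<open>X\<close> is an ideal, a matching with domain \<open>X\<close> is a permutation of \<open>X\<close>
  that moves nothing up, hence the identity, so \<open>f X = 0\<close>.  If \<open>X\<close> is not an ideal, say
  \<open>x \<preceq> y \<in> X\<close> and \<open>x \<notin> X\<close>, then matching \<open>y\<close> to \<open>x\<close> and all else to itself gives \<open>f X \<ge> 1\<close>.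
\<close>

text \<open>The two coordinates are the two sides of a bipartite graph. An element may thus occur
  once on each side, and a diagonal pair is an edge like any other.\<close>

definition is_matching :: "('a \<times> 'b) set \<Rightarrow> bool" where
  "is_matching M \<longleftrightarrow> inj_on fst M \<and> inj_on snd M"

lemma is_matching_subset: "is_matching M \<Longrightarrow> M' \<subseteq> M \<Longrightarrow> is_matching M'"
  unfolding is_matching_def by (meson inj_on_subset)

lemma is_matching_insert:
  assumes "is_matching M" "x \<notin> fst ` M" "y \<notin> snd ` M"
  shows "is_matching (insert (x, y) M)"
  using assms unfolding is_matching_def by auto

lemma is_matching_sndD: "is_matching M \<Longrightarrow> (x, z) \<in> M \<Longrightarrow> (y, z) \<in> M \<Longrightarrow> x = y"
  unfolding is_matching_def inj_on_def by fastforce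

lemma is_matching_remove:
  assumes "is_matching M" "(x, y) \<in> M"
  shows "fst ` (M - {(x, y)}) = fst ` M - {x}" "y \<notin> snd ` (M - {(x, y)})"
proof -
  show "fst ` (M - {(x, y)}) = fst ` M - {x}"
    using inj_on_image_set_diff[of fst M M "{(x, y)}"] assms by (simp add: is_matching_def)
  show "y \<notin> snd ` (M - {(x, y)})"
    using inj_on_image_set_diff[of snd M M "{(x, y)}"] assms by (simp add: is_matching_def)
qed

text \<open>Moving the edge at \<open>i\<close> from \<open>M\<close> to \<open>L\<close> may create
  a conflict at its right end; moving the conflicting edge of \<open>L\<close> to \<open>M\<close>
  may create one at its left end \<open>j\<close>, and so on along an alternating path. Induction on
  \<open>card M\<close> follows this path. Equal union and intersection say that edges are only
  redistributed, with multiplicity, so every additive weight keeps its total.\<close>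

lemma matching_exchange:
  assumes "finite M" "is_matching M" "is_matching L" "i \<in> fst ` M" "i \<notin> fst ` L"
  obtains M' L' where "is_matching M'" "is_matching L'" "M' \<union> L' = M \<union> L" "M' \<inter> L' = M \<inter> L"
    "fst ` M' = fst ` M - {i} \<and> fst ` L' = fst ` L \<union> {i} \<or>
     (\<exists>j \<in> fst ` L - fst ` M. fst ` M' = (fst ` M - {i}) \<union> {j} \<and> fst ` L' = (fst ` L \<union> {i}) - {j})"
  using assms
proof (induction "card M" arbitrary: M L i thesis rule: less_induct)
  case less
  from less.prems(5) obtain a where ia: "(i, a) \<in> M" by auto
  define M1 where "M1 = M - {(i, a)}"
  have M: "M = insert (i, a) M1" using ia by (auto simp: M1_def)
  have M1: "is_matching M1" unfolding M1_def using less.prems(3) by (rule is_matching_subset) blast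
  have fM1: "fst ` M1 = fst ` M - {i}" and aM1: "a \<notin> snd ` M1"
    unfolding M1_def using is_matching_remove[OF less.prems(3) ia] by auto
  have iaL: "(i, a) \<notin> L" using less.prems(6) by force
  show ?case
  proof (cases "a \<in> snd ` L")
    \<comment> \<open>The path stops at the right vertex \<open>a\<close>: \<open>L\<close> gains
      \<open>i\<close> and gives nothing back.\<close>
    case False
    with less.prems(4,6) have "is_matching (insert (i, a) L)"
      by (rule is_matching_insert)
    moreover have "M1 \<union> insert (i, a) L = M \<union> L" "M1 \<inter> insert (i, a) L = M \<inter> L"
      using ia iaL unfolding M1_def by blast+
    moreover have "fst ` insert (i, a) L = fst ` L \<union> {i}" by simp
    ultimately show ?thesis
      using M1 fM1 by (intro less.prems(1)[of M1 "insert (i, a) L"]) blast+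
  next
    case True
    then obtain j where ja: "(j, a) \<in> L" by auto
    define L1 where "L1 = L - {(j, a)}"
    have L: "L = insert (j, a) L1" using ja by (auto simp: L1_def)
    have L1: "is_matching L1" unfolding L1_def using less.prems(4) by (rule is_matching_subset) blast
    have fL1: "fst ` L1 = fst ` L - {j}" and aL1: "a \<notin> snd ` L1"
      unfolding L1_def using is_matching_remove[OF less.prems(4) ja] by auto
    have jL: "j \<in> fst ` L" using ja by force
    then have ij: "i \<noteq> j" using less.prems(6) by auto
    have iL1: "i \<notin> fst ` L1" using fL1 less.prems(6) by auto
    have fresh: "(x, a) \<notin> M1" "(x, a) \<notin> L1" for x using aM1 aL1 by force+
    show ?thesis
    proof (cases "j \<in> fst ` M")
      \<comment> \<open>The path stops at the left vertex \<open>j\<close>, which is the element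
        exchanged for \<open>i\<close>.\<close>
      case False
      then have "is_matching (insert (j, a) M1)"
        using is_matching_insert[OF M1] aM1 fM1 by auto
      moreover have "is_matching (insert (i, a) L1)"
        using is_matching_insert[OF L1] aL1 iL1 by auto
      moreover have "insert (j, a) M1 \<union> insert (i, a) L1 = M \<union> L" by (auto simp: M L)
      moreover have "insert (j, a) M1 \<inter> insert (i, a) L1 = M \<inter> L"
        using ij fresh by (auto simp: M L)
      moreover have "fst ` insert (j, a) M1 = (fst ` M - {i}) \<union> {j}"
        "fst ` insert (i, a) L1 = (fst ` L \<union> {i}) - {j}"
        using fM1 fL1 ij by auto
      ultimately show ?thesis
        using False jL by (intro less.prems(1)[of "insert (j, a) M1" "insert (i, a) L1"]) blast+
    next
      \<comment> \<open>Without the two edges at \<open>a\<close>, the vertex \<open>j\<close> is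
        covered by \<open>M1\<close> but not by \<open>L1\<close>, so it takes over the role of
        \<open>i\<close> in the induction hypothesis. Afterwards the two edges are put back
        crosswise.\<close>
      case True
      have "card M1 < card M"
        using less.prems(2) ia unfolding M1_def by (rule card_Diff1_less)
      moreover have "finite M1" "j \<in> fst ` M1" "j \<notin> fst ` L1"
        using less.prems(2) True ij fM1 fL1 by (auto simp: M1_def)
      ultimately obtain M' L' where *: "is_matching M'" "is_matching L'"
        "M' \<union> L' = M1 \<union> L1" "M' \<inter> L' = M1 \<inter> L1"
        "fst ` M' = fst ` M1 - {j} \<and> fst ` L' = fst ` L1 \<union> {j} \<or>
         (\<exists>k \<in> fst ` L1 - fst ` M1.
            fst ` M' = (fst ` M1 - {j}) \<union> {k} \<and> fst ` L' = (fst ` L1 \<union> {j}) - {k})"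
        using less.hyps[of M1 L1 j] M1 L1 by metis
      \<comment> \<open>The rest of the path only redistributes edges of \<open>M1\<close> and
        \<open>L1\<close>, so \<open>a\<close> is still free on both sides.\<close>
      have "snd ` M' \<union> snd ` L' = snd ` M1 \<union> snd ` L1"
        using *(3) by (metis image_Un)
      then have aM': "a \<notin> snd ` M'" and aL': "a \<notin> snd ` L'" using aM1 aL1 by auto
      have fresh': "(x, a) \<notin> M'" "(x, a) \<notin> L'" for x using aM' aL' by force+
      have "j \<notin> fst ` M'" using *(5) \<open>j \<notin> fst ` L1\<close> by auto
      then have 1: "is_matching (insert (j, a) M')" by (rule is_matching_insert[OF *(1) _ aM'])
      have "i \<notin> fst ` L'" using *(5) iL1 ij by auto
      then have 2: "is_matching (insert (i, a) L')" by (rule is_matching_insert[OF *(2) _ aL'])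
      have 3: "insert (j, a) M' \<union> insert (i, a) L' = M \<union> L" using *(3) by (auto simp: M L)
      have 4: "insert (j, a) M' \<inter> insert (i, a) L' = M \<inter> L"
        using ij fresh fresh' *(4) by (auto simp: M L)
      have 5: "fst ` insert (j, a) M' = fst ` M - {i} \<and> fst ` insert (i, a) L' = fst ` L \<union> {i} \<or>
        (\<exists>k \<in> fst ` L - fst ` M. fst ` insert (j, a) M' = (fst ` M - {i}) \<union> {k} \<and>
           fst ` insert (i, a) L' = (fst ` L \<union> {i}) - {k})"
        using *(5)
      proof (elim disjE bexE)
        assume "fst ` M' = fst ` M1 - {j} \<and> fst ` L' = fst ` L1 \<union> {j}"
        then show ?thesis using fM1 fL1 True jL ij by auto
      next
        fix k
        assume k: "k \<in> fst ` L1 - fst ` M1"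
          and eq: "fst ` M' = (fst ` M1 - {j}) \<union> {k} \<and> fst ` L' = (fst ` L1 \<union> {j}) - {k}"
        have kij: "k \<noteq> i" "k \<noteq> j" using k iL1 \<open>j \<notin> fst ` L1\<close> by auto
        have "k \<in> fst ` L - fst ` M" using k fM1 fL1 kij(1) by auto
        moreover have "fst ` insert (j, a) M' = (fst ` M - {i}) \<union> {k}"
          using eq fM1 True ij by auto
        moreover have "fst ` insert (i, a) L' = (fst ` L \<union> {i}) - {k}"
          using eq fL1 jL kij by auto
        ultimately show ?thesis by (intro disjI2 bexI[of _ k] conjI)
      qed
      show ?thesis by (rule less.prems(1)[OF 1 2 3 4 5])
    qed
  qed
qed

definition matchings_from :: "('a \<times> 'b) set \<Rightarrow> 'a set \<Rightarrow> ('a \<times> 'b) set set" where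
  "matchings_from E X = {M. M \<subseteq> E \<and> is_matching M \<and> fst ` M = X}"

text \<open>This is the value of a maximum-weight assignment with weight 0 on diagonal pairs and 1
  on all others. \<open>Max\<close> of the empty set is unspecified, so at least one matching with
  domain \<open>X\<close> must exist; the diagonal will provide it.\<close>

definition max_off_diag :: "'a rel \<Rightarrow> 'a set \<Rightarrow> nat" where
  "max_off_diag E X = Max ((\<lambda>M. card (M - Id)) ` matchings_from E X)"

lemma finite_matchings_from: "finite E \<Longrightarrow> finite (matchings_from E X)"
  by (rule finite_subset[of _ "Pow E"]) (auto simp: matchings_from_def)

lemma max_off_diag_ge:
  "finite E \<Longrightarrow> M \<in> matchings_from E X \<Longrightarrow> card (M - Id) \<le> max_off_diag E X"
  unfolding max_off_diag_def by (intro Max_ge) (auto simp: finite_matchings_from)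

lemma max_off_diag_attained:
  assumes "finite E" "matchings_from E X \<noteq> {}"
  obtains M where "M \<in> matchings_from E X" "card (M - Id) = max_off_diag E X"
proof -
  have "max_off_diag E X \<in> (\<lambda>M. card (M - Id)) ` matchings_from E X"
    unfolding max_off_diag_def using assms by (intro Max_in) (auto simp: finite_matchings_from)
  then show ?thesis using that by auto
qed

lemma Id_on_in_matchings_from: "Id_on X \<subseteq> E \<Longrightarrow> Id_on X \<in> matchings_from E X"
  by (force simp: matchings_from_def is_matching_def inj_on_def)

text \<open>The exchange turns optimal matchings for \<open>X\<close> and \<open>Y\<close> into
  feasible ones for the two new domains with the same total weight; the maxima there can only be
  larger.\<close>

lemma M_natural_concave_on_max_off_diag:
  assumes "finite E" "Id_on N \<subseteq> E"
  shows "M_natural_concave_on N (\<lambda>X. real (max_off_diag E X))"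
  unfolding M_natural_concave_on_def
proof (intro allI impI ballI)
  fix X Y i assume XY: "X \<subseteq> N \<and> Y \<subseteq> N" and i: "i \<in> X - Y"
  have "matchings_from E Z \<noteq> {}" if "Z \<subseteq> N" for Z
    using Id_on_in_matchings_from[of Z E] that assms(2) by (auto simp: Id_on_def)
  then obtain M L where M: "M \<in> matchings_from E X" "card (M - Id) = max_off_diag E X"
    and L: "L \<in> matchings_from E Y" "card (L - Id) = max_off_diag E Y"
    using max_off_diag_attained[OF assms(1)] XY by metis
  have match: "M \<subseteq> E" "is_matching M" "fst ` M = X" "L \<subseteq> E" "is_matching L" "fst ` L = Y"
    using M L by (auto simp: matchings_from_def)
  have "finite M" "finite L" using match assms(1) finite_subset by auto
  obtain M' L' where *: "is_matching M'" "is_matching L'" "M' \<union> L' = M \<union> L" "M' \<inter> L' = M \<inter> L"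
    "fst ` M' = X - {i} \<and> fst ` L' = Y \<union> {i} \<or>
     (\<exists>j \<in> Y - X. fst ` M' = (X - {i}) \<union> {j} \<and> fst ` L' = (Y \<union> {i}) - {j})"
  proof (rule matching_exchange)
    show "finite M" "is_matching M" "is_matching L" "i \<in> fst ` M" "i \<notin> fst ` L"
      using \<open>finite M\<close> match i by auto
  qed (use match in simp)
  have sub: "M' \<subseteq> E" "L' \<subseteq> E" using *(3) match by auto
  then have fin: "finite M'" "finite L'" using assms(1) finite_subset by auto
  have "(M - Id) \<union> (L - Id) = (M' - Id) \<union> (L' - Id)" "(M - Id) \<inter> (L - Id) = (M' - Id) \<inter> (L' - Id)"
    using *(3,4) by blast+
  \<comment> \<open>The sum of two cardinalities depends only on the union and the
    intersection.\<close>
  then have "card (M - Id) + card (L - Id) = card (M' - Id) + card (L' - Id)"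
    using card_Un_Int[of "M - Id" "L - Id"] card_Un_Int[of "M' - Id" "L' - Id"]
      \<open>finite M\<close> \<open>finite L\<close> fin by simp
  then have total: "max_off_diag E X + max_off_diag E Y = card (M' - Id) + card (L' - Id)"
    using M(2) L(2) by simp
  have "M' \<in> matchings_from E (fst ` M')" "L' \<in> matchings_from E (fst ` L')"
    using sub *(1,2) by (auto simp: matchings_from_def)
  then have "max_off_diag E X + max_off_diag E Y
      \<le> max_off_diag E (fst ` M') + max_off_diag E (fst ` L')"
    unfolding total using assms(1) by (intro add_mono max_off_diag_ge)
  then have "real (max_off_diag E X) + real (max_off_diag E Y)
      \<le> real (max_off_diag E (fst ` M')) + real (max_off_diag E (fst ` L'))"
    by linarith
  then show "real (max_off_diag E X) + real (max_off_diag E Y)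
        \<le> real (max_off_diag E (X - {i})) + real (max_off_diag E (Y \<union> {i})) \<or>
      (\<exists>j \<in> Y - X. real (max_off_diag E X) + real (max_off_diag E Y)
        \<le> real (max_off_diag E ((X - {i}) \<union> {j})) + real (max_off_diag E ((Y \<union> {i}) - {j})))"
    using *(5) by metis
qed

text \<open>If \<open>y\<close> is matched to some \<open>x\<close> strictly below it, then
  \<open>x\<close> is itself in the domain and, by induction, matched to itself. So \<open>x\<close>
  would be the partner of both \<open>x\<close> and \<open>y\<close>.\<close>

lemma descending_matching_subset_Id:
  assumes "wf (r - Id)" "is_matching M" "M \<subseteq> r\<inverse>" "snd ` M \<subseteq> fst ` M"
  shows "M \<subseteq> Id"
proof -
  have "\<forall>x. (y, x) \<in> M \<longrightarrow> x = y" for y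
  proof (induction y rule: wf_induct_rule[OF assms(1)])
    case (1 y)
    show ?case
    proof (intro allI impI, rule ccontr)
      fix x assume yx: "(y, x) \<in> M" and "x \<noteq> y"
      then obtain z where xz: "(x, z) \<in> M" using assms(4) by force
      have "(x, y) \<in> r - Id" using yx \<open>x \<noteq> y\<close> assms(3) by auto
      then have "z = x" using 1 xz by blast
      then show False using is_matching_sndD[OF assms(2)] yx xz \<open>x \<noteq> y\<close> by blast
    qed
  qed
  then show ?thesis by auto
qed

theorem theorem4:
  fixes N :: "'a set" and r :: "'a rel"
  assumes "finite N" and "partial_order_on N r"
  shows "\<exists>f :: 'a set \<Rightarrow> real. M_natural_concave_on N f \<and>
           (\<forall>X. X \<subseteq> N \<longrightarrow>
              (X \<in> poset_ideals N r \<longrightarrow> f X = 0) \<and>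
              (X \<notin> poset_ideals N r \<longrightarrow> f X > 0))"
proof -
  \<comment> \<open>Edges lead from an element to those below it; reflexivity puts the diagonal of
    \<open>N\<close> into \<open>E\<close>.\<close>
  define E where "E = r\<inverse>"
  have r: "refl_on N r" "r \<subseteq> N \<times> N" using partial_order_onD[OF assms(2)] by auto
  then have "finite r" using assms(1) finite_subset by blast
  then have wfr: "wf (r - Id)" and finE: "finite E"
    using assms(2) partial_order_on_well_order_on by (auto simp: E_def)
  have IdE: "Id_on N \<subseteq> E" using r(1) by (auto simp: E_def refl_on_def)
  have zero: "max_off_diag E X = 0" if X: "X \<in> poset_ideals N r" for X
  proof -
    have "X \<subseteq> N" using X by (auto simp: poset_ideals_def)
    then have "matchings_from E X \<noteq> {}"
      using Id_on_in_matchings_from[of X E] IdE by (auto simp: Id_on_def)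
    then obtain M where M: "M \<in> matchings_from E X" "card (M - Id) = max_off_diag E X"
      using max_off_diag_attained[OF finE] by blast
    \<comment> \<open>Partners lie below elements of \<open>X\<close>, so they stay in the ideal
      \<open>X\<close>, which is the domain of \<open>M\<close>.\<close>
    have "snd ` M \<subseteq> fst ` M"
    proof
      fix x assume "x \<in> snd ` M"
      then obtain y where "(y, x) \<in> M" by auto
      then have "(x, y) \<in> r" "y \<in> X" using M(1) by (force simp: matchings_from_def E_def)+
      then show "x \<in> fst ` M"
        using M(1) X r(2) unfolding matchings_from_def poset_ideals_def by blast
    qed
    then have "M \<subseteq> Id"
      using M(1) by (intro descending_matching_subset_Id[OF wfr]) (auto simp: matchings_from_def E_def)
    then have "M - Id = {}" by blast
    then show ?thesis using M(2) by (metis card.empty)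
  qed
  have pos: "max_off_diag E X > 0" if X: "X \<subseteq> N" "X \<notin> poset_ideals N r" for X
  proof -
    obtain x y where xy: "x \<in> N" "y \<in> X" "(x, y) \<in> r" "x \<notin> X"
      using X unfolding poset_ideals_def by blast
    \<comment> \<open>As \<open>x\<close> is outside \<open>X\<close>, no element matched to itself
      competes for it.\<close>
    define M where "M = insert (y, x) (Id_on (X - {y}))"
    have "is_matching M"
      unfolding M_def using xy(4)
      by (intro is_matching_insert) (auto simp: is_matching_def inj_on_def)
    moreover have "M \<subseteq> E"
      using IdE xy X(1) by (auto simp: M_def E_def)
    moreover have "fst ` M = X"
      using xy(2) by (force simp: M_def)
    ultimately have "M \<in> matchings_from E X" by (simp add: matchings_from_def)
    moreover have "(y, x) \<in> M - Id" using xy by (auto simp: M_def)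
    moreover have "finite (M - Id)" using \<open>M \<subseteq> E\<close> finE finite_subset by blast
    ultimately show ?thesis
      using max_off_diag_ge[OF finE] by (metis card_gt_0_iff empty_iff less_le_trans)
  qed
  show ?thesis
    using M_natural_concave_on_max_off_diag[OF finE IdE] zero pos
    by (intro exI[of _ "\<lambda>X. real (max_off_diag E X)"]) auto
qed

end
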